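(* Let $n\geq 1$ and $p\geq 1$ be integers. Then $$[z^{2n-1}]\left\{(\arcsin z)^{2p-1}\sum_{k=0}^{n-1}(-1)^k\left\langle {2n-1\atop k}\right\rangle^{B}U_{2n-2k-2}(z)\right\}=(-1)^{n-1}2^{2n-2}(2n-1)!\,\delta_{p,n},$$ and $$[z^{2n}]\left\{(\arcsin z)^{2p}\sum_{k=0}^{n-1}(-1)^k\left\langle {2n\atop k}\right\rangle U_{2n-2k-2}(z)\right\}=\frac{(-1)^{n-1}}{2}(2n)!\,\delta_{p,n},$$ where $\delta_{p,n}$ is the Kronecker delta.
   Context: $\left\langle {m\atop k}\right\rangle$ and $\left\langle {m\atop k}\right\rangle^{B}$ denote the Eulerian numbers of type $A$ and type $B$. They are the coefficients of the Eulerian polynomials $A_m(x)=\sum_{k=0}^{m-1}\left\langle {m\atop k}\right\rangle x^k$ and $B_m(x)=\sum_{k=0}^{m}\left\langle {m\atop k}\right\rangle^{B}x^k$ ($m\ge1$), which are characterized by $\frac{A_m(x)}{(1-x)^{m+1}}=\sum_{r\ge0}(r+1)^m x^r$ and $\frac{B_m(x)}{(1-x)^{m+1}}=\sum_{r\ge0}(2r+1)^m x^r$. $U_m$ is the Chebyshev polynomial of the second kind, normalized by $U_m(\cos\theta)=\frac{\sin((m+1)\theta)}{\sin\theta}$. $[z^r]F(z)$ denotes the coefficient of $z^r$ in the expansion of $F$ at the origin; $\arcsin$ is the principal branch. *)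

theory Defs
  imports "HOL-Complex_Analysis.Complex_Analysis"
begin

text \<open>
  The Eulerian polynomials are introduced by their characterizing identities
  \<open>A\<^sub>m(x) / (1 - x)^(m+1) = (\<Sum>r. (r+1)^m x^r)\<close> and
  \<open>B\<^sub>m(x) / (1 - x)^(m+1) = (\<Sum>r. (2r+1)^m x^r)\<close>, multiplied out so that they make sense
  over the integers. That such polynomials exist is \<open>eulerian_poly_A\<close> and
  \<open>eulerian_poly_B\<close> below.
\<close>

definition eulerian_poly_A :: "nat \<Rightarrow> int poly" where
  "eulerian_poly_A m =
     (THE P. fps_of_poly P = (1 - fps_X) ^ (m + 1) * Abs_fps (\<lambda>r. (of_nat r + 1) ^ m))"

definition eulerian_poly_B :: "nat \<Rightarrow> int poly" where
  "eulerian_poly_B m =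
     (THE P. fps_of_poly P = (1 - fps_X) ^ (m + 1) * Abs_fps (\<lambda>r. (2 * of_nat r + 1) ^ m))"

definition eulerian_A :: "nat \<Rightarrow> nat \<Rightarrow> int" where
  "eulerian_A m k = coeff (eulerian_poly_A m) k"

definition eulerian_B :: "nat \<Rightarrow> nat \<Rightarrow> int" where
  "eulerian_B m k = coeff (eulerian_poly_B m) k"

text \<open>Existence and uniqueness are \<open>chebyshev_U_cos\<close> and \<open>chebyshev_U_unique\<close> below.\<close>

definition chebyshev_U :: "nat \<Rightarrow> complex poly" where
  "chebyshev_U m =
     (THE P. \<forall>\<theta>. sin \<theta> \<noteq> 0 \<longrightarrow> poly P (cos \<theta>) = sin (of_nat (m + 1) * \<theta>) / sin \<theta>)"


subsection \<open>Well-definedness of the Eulerian polynomials\<close>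

fun eulerian_rec :: "int \<Rightarrow> nat \<Rightarrow> int poly" where
  "eulerian_rec a 0 = 1"
| "eulerian_rec a (Suc m) =
     [:0, a:] * ([:1, -1:] * pderiv (eulerian_rec a m) + of_nat (m + 1) * eulerian_rec a m)
     + [:1, -1:] * eulerian_rec a m"

lemma fps_of_poly_eulerian_rec:
  "fps_of_poly (eulerian_rec a m) =
     (1 - fps_X) ^ (m + 1) * Abs_fps (\<lambda>r. (a * of_nat r + 1) ^ m)"
proof (induction m)
  case 0
  have "(1 - fps_X) * Abs_fps (\<lambda>r. 1 :: int) = 1"
    by (intro fps_ext) (auto simp: algebra_simps)
  then show ?case by simp
next
  case (Suc m)
  define F where "F = Abs_fps (\<lambda>r. (a * of_nat r + 1) ^ m)"
  define Y where "Y = (1 - fps_X :: int fps)"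
  have step: "Abs_fps (\<lambda>r. (a * of_nat r + 1) ^ Suc m) = fps_const a * fps_X * fps_deriv F + F"
    by (intro fps_ext) (auto simp: F_def mult.assoc algebra_simps)
  have IH: "fps_of_poly (eulerian_rec a m) = Y ^ (m + 1) * F"
    using Suc.IH by (simp add: F_def Y_def)
  have dY: "fps_deriv (Y ^ (m + 1)) = - (of_nat (m + 1) * Y ^ m)"
    by (simp add: fps_deriv_power' Y_def algebra_simps del: power_Suc)
  have lin: "fps_of_poly [:1, -1:] = Y" "fps_of_poly [:0, a:] = fps_const a * fps_X"
    by (simp_all add: Y_def fps_of_poly_pCons fps_of_poly_const algebra_simps)
  have nat: "fps_of_poly (of_nat k) = (of_nat k :: int fps)" for k
    by (induction k) (simp_all add: fps_of_poly_add)
  have "fps_of_poly (eulerian_rec a (Suc m)) =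
          fps_const a * fps_X * (Y * fps_deriv (Y ^ (m + 1) * F) + of_nat (m + 1) * (Y ^ (m + 1) * F))
          + Y * (Y ^ (m + 1) * F)"
    by (simp only: eulerian_rec.simps fps_of_poly_add fps_of_poly_mult fps_of_poly_pderiv lin nat IH)
  also have "Y * fps_deriv (Y ^ (m + 1) * F) + of_nat (m + 1) * (Y ^ (m + 1) * F)
             = Y ^ (m + 2) * fps_deriv F"
    unfolding fps_deriv_mult dY by (simp add: algebra_simps)
  also have "fps_const a * fps_X * (Y ^ (m + 2) * fps_deriv F) + Y * (Y ^ (m + 1) * F)
             = Y ^ (Suc m + 1) * (fps_const a * fps_X * fps_deriv F + F)"
    by (simp add: algebra_simps)
  finally show ?case
    unfolding step Y_def .
qed

lemma eulerian_poly_A_eq_rec: "eulerian_poly_A m = eulerian_rec 1 m"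
  unfolding eulerian_poly_A_def using fps_of_poly_eulerian_rec[of 1 m]
  by (intro the_equality) (simp_all flip: fps_of_poly_eq_iff)

lemma eulerian_poly_B_eq_rec: "eulerian_poly_B m = eulerian_rec 2 m"
  unfolding eulerian_poly_B_def using fps_of_poly_eulerian_rec[of 2 m]
  by (intro the_equality) (simp_all flip: fps_of_poly_eq_iff)

lemma eulerian_poly_A:
  "fps_of_poly (eulerian_poly_A m) = (1 - fps_X) ^ (m + 1) * Abs_fps (\<lambda>r. (of_nat r + 1) ^ m)"
  using fps_of_poly_eulerian_rec[of 1 m] by (simp add: eulerian_poly_A_eq_rec)

lemma eulerian_poly_B:
  "fps_of_poly (eulerian_poly_B m) = (1 - fps_X) ^ (m + 1) * Abs_fps (\<lambda>r. (2 * of_nat r + 1) ^ m)"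
  using fps_of_poly_eulerian_rec[of 2 m] by (simp add: eulerian_poly_B_eq_rec)


subsection \<open>Well-definedness of the Chebyshev polynomials\<close>

fun chebyshev_rec :: "nat \<Rightarrow> complex poly" where
  "chebyshev_rec 0 = 1"
| "chebyshev_rec (Suc 0) = [:0, 2:]"
| "chebyshev_rec (Suc (Suc m)) = [:0, 2:] * chebyshev_rec (Suc m) - chebyshev_rec m"

lemma chebyshev_rec_cos:
  "poly (chebyshev_rec m) (cos \<theta>) * sin \<theta> = sin (of_nat (m + 1) * \<theta>)"
proof (induction m rule: chebyshev_rec.induct)
  case 1
  then show ?case by simp
next
  case 2
  then show ?case by (simp add: sin_double)
next
  case (3 m)
  have "sin (of_nat (m + 3) * \<theta>) + sin (of_nat (m + 1) * \<theta>) = 2 * cos \<theta> * sin (of_nat (m + 2) * \<theta>)"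
    using sin_add[of "of_nat (m + 2) * \<theta>" \<theta>] sin_diff[of "of_nat (m + 2) * \<theta>" \<theta>]
    by (simp add: algebra_simps)
  then show ?case using "3.IH"
    by (simp add: left_diff_distrib mult.assoc) (simp add: algebra_simps)
qed

lemma chebyshev_U_unique:
  fixes P Q :: "complex poly"
  assumes "\<And>\<theta>. sin \<theta> \<noteq> 0 \<Longrightarrow> poly P (cos \<theta>) = poly Q (cos \<theta>)"
  shows "P = Q"
proof -
  have "poly (P - Q) x = 0" if "x \<notin> {-1, 1}" for x
  proof -
    have "x\<^sup>2 \<noteq> 1" using that by (auto simp: power2_eq_1_iff)
    then have "sin (Arccos x) \<noteq> 0"
      using sin_cos_squared_add[of "Arccos x"] by auto
    then show ?thesis using assms[of "Arccos x"] by simp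
  qed
  then have "-{-1, 1} \<subseteq> {x. poly (P - Q) x = 0}" by blast
  moreover have "infinite (-{-1, 1 :: complex})"
    by (metis finite.emptyI finite_compl finite_insert infinite_UNIV_char_0)
  ultimately have "infinite {x. poly (P - Q) x = 0}"
    using finite_subset by blast
  then show ?thesis using poly_roots_finite[of "P - Q"] by auto
qed

lemma chebyshev_U_eq_rec: "chebyshev_U m = chebyshev_rec m"
  unfolding chebyshev_U_def
proof (rule the_equality)
  show *: "\<forall>\<theta>. sin \<theta> \<noteq> 0 \<longrightarrow>
             poly (chebyshev_rec m) (cos \<theta>) = sin (of_nat (m + 1) * \<theta>) / sin \<theta>"
    by (simp add: eq_divide_eq chebyshev_rec_cos del: of_nat_add)
  show "P = chebyshev_rec m"
    if "\<forall>\<theta>. sin \<theta> \<noteq> 0 \<longrightarrow> poly P (cos \<theta>) = sin (of_nat (m + 1) * \<theta>) / sin \<theta>" for P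
    using that * by (intro chebyshev_U_unique) metis
qed

lemma chebyshev_U_cos:
  "sin \<theta> \<noteq> 0 \<Longrightarrow> poly (chebyshev_U m) (cos \<theta>) = sin (of_nat (m + 1) * \<theta>) / sin \<theta>"
  using chebyshev_rec_cos[of m \<theta>] by (simp add: chebyshev_U_eq_rec eq_divide_eq)

end

theory Submission
  imports Defs
begin

text \<open>
  Substituting \<open>z = sin \<theta>\<close> in the residue that gives the coefficient,
  \<open>[z^m] F(z) = Res F(sin \<theta>) cos \<theta> / (sin \<theta>)^(m+1)\<close> at \<open>\<theta> = 0\<close>, and
  \<open>U_{2l}(sin \<theta>) cos \<theta> = (-1)^l cos ((2l+1)\<theta>)\<close>. As the Eulerian numbers are symmetric, the
  resulting cosine sum is half of \<open>e^(i(2n-1)\<theta>) P(e^(-2i\<theta>))\<close> up to sign, \<open>P\<close> being the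
  Eulerian polynomial. Since \<open>1 - e^(-2i\<theta>) = 2i e^(-i\<theta>) sin \<theta>\<close>, the characterization of
  \<open>P\<close> turns the quotient by \<open>(sin \<theta>)^(m+1)\<close> into a multiple of the \<open>m\<close>-th derivative of
  \<open>1/sin \<theta>\<close> (type B) or \<open>cot \<theta>\<close> (type A), which has a simple pole at \<open>0\<close>. Multiplied by
  \<open>\<theta>^q\<close>, this derivative has a residue only for \<open>q = m\<close>.

  Both types are treated together: for \<open>a = 2\<close> (type B) and \<open>a = 1\<close> (type A), put \<open>s = 2/a\<close>;
  then \<open>m = 2n - 2 + s\<close>.
\<close>

unbundle fps_syntax

section \<open>Symmetry of the Eulerian polynomials\<close>

definition palindromic :: "nat \<Rightarrow> 'a::zero poly \<Rightarrow> bool" where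
  "palindromic N p \<longleftrightarrow> (\<forall>k\<le>N. coeff p (N - k) = coeff p k) \<and> (\<forall>k>N. coeff p k = 0)"

lemma coeff_eulerian_rec_0: "coeff (eulerian_rec a m) 0 = 1"
  by (induction m) simp_all

lemma of_nat_poly_mult: "of_nat n * (p :: int poly) = smult (of_nat n) p"
  by (simp add: of_nat_poly)

lemma coeff_eulerian_rec_Suc:
  "coeff (eulerian_rec a (Suc m)) (Suc k) =
     (a * of_nat (Suc k) + 1) * coeff (eulerian_rec a m) (Suc k)
     + (a * (of_nat m + 1 - of_nat k) - 1) * coeff (eulerian_rec a m) k"
  by (cases k) (simp_all add: of_nat_poly_mult coeff_pderiv algebra_simps del: of_nat_Suc of_nat_add,
       simp_all add: of_nat_poly_mult algebra_simps)

text \<open>With \<open>a * (t + 1) = 2\<close> and \<open>m = N + t\<close>, the two weights of the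
  coefficient recurrence become \<open>a * (k + 1) + 1\<close> and \<open>a * (N - k) + 1\<close>.
  The reflection k -> N - 1 - k exchanges them, so symmetry passes from N to N + 1.\<close>

lemma palindromic_eulerian_rec:
  assumes "a * (int t + 1) = 2"
  shows "palindromic N (eulerian_rec a (N + t))"
proof (induction N)
  case 0
  \<comment> \<open>Only (a, t) = (2, 0) and (1, 1) satisfy the hypothesis, so the base cases are
    B_0 = 1 and A_1 = 1.\<close>
  have "eulerian_rec a t = 1"
  proof -
    have "t = 0 \<or> (t = 1 \<and> a = 1)"
    proof -
      have "int t + 1 dvd 2" using assms by (metis dvd_triv_right)
      then have "int t + 1 \<le> 2" by (rule zdvd_imp_le) simp
      then have "t = 0 \<or> t = 1" by linarith
      with assms show ?thesis by auto
    qed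
    then show ?thesis by (auto simp: one_pCons)
  qed
  then show ?case by (simp add: palindromic_def)
next
  case (Suc N)
  define c where "c = coeff (eulerian_rec a (N + t))"
  define d where "d = coeff (eulerian_rec a (Suc N + t))"
  have sym: "c (N - k) = c k" if "k \<le> N" for k
    using Suc that by (simp add: palindromic_def c_def)
  have van: "c k = 0" if "k > N" for k
    using Suc that by (simp add: palindromic_def c_def)
  have c0: "c 0 = 1" and d0: "d 0 = 1"
    by (simp_all only: c_def d_def coeff_eulerian_rec_0)
  have rec: "d (Suc k) = (a * int (Suc k) + 1) * c (Suc k) + (a * (int N - int k) + 1) * c k" for k
  proof -
    have "a * (int (N + t) + 1 - int k) - 1 = a * (int N - int k) + 1"
      using assms by (simp add: algebra_simps)
    then show ?thesis
      by (simp only: c_def d_def add_Suc coeff_eulerian_rec_Suc)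
  qed
  have cN: "c N = 1" using sym[of N] c0 by simp
  have dN: "d (Suc N) = 1" using rec[of N] van[of "Suc N"] cN by simp
  have "d (Suc N - k) = d k" if "k \<le> Suc N" for k
  proof (cases k)
    case 0
    then show ?thesis using d0 dN by simp
  next
    case (Suc j)
    show ?thesis
    proof (cases "j = N")
      case True
      then show ?thesis using Suc d0 dN by simp
    next
      case False
      then have j: "j < N" using that Suc by simp
      \<comment> \<open>Here \<open>Suc i\<close> is the mirror image of \<open>Suc j\<close> in the
        row of degree \<open>Suc N\<close>.\<close>
      define i where "i = N - Suc j"
      have N: "N = Suc (i + j)" using j by (simp add: i_def)
      have "d (Suc i) = (a * int (Suc i) + 1) * c (Suc i) + (a * (int N - int i) + 1) * c i"
        by (rule rec)
      moreover have "c (Suc i) = c j" using sym[of j] j N by (simp add: Suc_diff_le)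
      moreover have "c i = c (Suc j)" using sym[of "Suc j"] j by (simp add: i_def)
      ultimately have "d (Suc i) = d (Suc j)"
        unfolding rec[of j] by (simp add: N algebra_simps)
      then show ?thesis using Suc N by simp
    qed
  qed
  moreover have "d k = 0" if "k > Suc N" for k
    using that rec[of "k - 1"] van[of k] van[of "k - 1"] by simp
  ultimately show ?case by (simp add: palindromic_def d_def)
qed

section \<open>Formal derivatives and residues\<close>

text \<open>The rising factorial is (k+1)...(k+m). It vanishes for -m <= k <= -1, which later
  disposes of the case q < m.\<close>

lemma fls_deriv_funpow_nth:
  fixes f :: "'a::comm_ring_1 fls"
  shows "(fls_deriv ^^ m) f $$ k = pochhammer (of_int k + 1) m * f $$ (k + int m)"
proof (induction m arbitrary: k)
  case (Suc m)
  have "(fls_deriv ^^ Suc m) f $$ k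
          = of_int (k + 1) * (pochhammer (of_int (k + 1) + 1) m * f $$ (k + 1 + int m))"
    using Suc[of "k + 1"] by simp
  then show ?case by (simp add: pochhammer_rec mult.assoc algebra_simps)
qed simp

lemma map_poly_of_int_add:
  "map_poly of_int (p + q) = (map_poly of_int p + map_poly of_int q :: 'a::comm_ring_1 poly)"
  by (intro poly_eqI) (simp add: coeff_map_poly)

lemma fps_deriv_poly_of_int:
  fixes p :: "int poly" and x :: "'a::comm_ring_1 fps"
  shows "fps_deriv (poly (map_poly of_int p) x) = poly (map_poly of_int (pderiv p)) x * fps_deriv x"
proof (induction p)
  case (pCons c p)
  show ?case using pCons
    by (simp add: map_poly_pCons pderiv_pCons map_poly_of_int_add algebra_simps)
qed simp

text \<open>Split F at degree m. The tail is divisible by z^(m+1) and leaves a power series, without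
  residue. The term of degree j < m gives a multiple of the derivative of S^(j-m), again without
  residue. For j = m the logarithmic derivative of S remains, whose residue is the order of the
  zero, namely 1.\<close>

lemma fls_nth_eq_fls_residue_sin_subst:
  fixes F :: "complex fps"
  defines "S \<equiv> fps_sin 1" and "C \<equiv> fps_cos 1"
  shows "fps_nth F m = (fps_to_fls ((F oo S) * C) / fps_to_fls S ^ Suc m) $$ -1"
proof -
  define S' where "S' = fps_to_fls S"
  define C' where "C' = fps_to_fls C"
  have S0: "S $ 0 = 0" by (simp add: S_def)
  have "S $ Suc 0 \<noteq> 0" by (simp add: S_def)
  then have [simp]: "S' \<noteq> 0" by (auto simp: S'_def)
  have dS: "fls_deriv S' = C'"
    by (simp add: S'_def C'_def S_def C_def fls_deriv_fps_to_fls fps_sin_deriv)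
  have expand: "(\<Sum>j\<le>m. fps_const (F $ j) * fps_X ^ j) + fps_shift (Suc m) F * fps_X ^ Suc m = F"
  proof -
    have "(fps_const c * fps_X ^ j) $ n = (if n = j then c else 0)" for c :: complex and j n
      by (simp add: fps_X_power_nth)
    then have "(\<Sum>j\<le>m. fps_const (F $ j) * fps_X ^ j) = fps_cutoff (Suc m) F"
      by (intro fps_ext) (simp add: fps_sum_nth less_Suc_eq_le del: fps_mult_fps_X_power_nonzero)
    then show ?thesis using fps_shift_cutoff[of "Suc m" F] by (simp add: add.commute)
  qed
  have "F oo S = (\<Sum>j\<le>m. fps_const (F $ j) * S ^ j) + (fps_shift (Suc m) F oo S) * S ^ Suc m"
    by (subst expand[symmetric])
       (simp only: fps_compose_add_distrib fps_compose_sum_distrib fps_compose_mult_distrib[OF S0]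
          fps_const_compose fps_compose_power[OF S0, symmetric] fps_X_fps_compose_startby0[OF S0])
  moreover have "fps_to_fls (sum f A) = (\<Sum>j\<in>A. fps_to_fls (f j))" for f :: "nat \<Rightarrow> complex fps" and A
    by (induction A rule: infinite_finite_induct) simp_all
  ultimately have "fps_to_fls ((F oo S) * C) / S' ^ Suc m =
      (\<Sum>j\<le>m. fls_const (F $ j) * (C' * S' ^ j / S' ^ Suc m)) + fps_to_fls ((fps_shift (Suc m) F oo S) * C)"
    by (simp add: fls_times_fps_to_fls fps_to_fls_power sum_distrib_left sum_divide_distrib
          add_divide_distrib S'_def[symmetric] C'_def[symmetric] algebra_simps del: power_Suc)
  moreover have "(C' * S' ^ j / S' ^ Suc m) $$ -1 = (if j = m then 1 else 0)" if "j \<le> m" for j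
  proof (cases "j = m")
    case True
    have "fls_subdegree S' = 1"
      by (intro fls_subdegree_eqI) (auto simp: S'_def S_def fps_sin_def nat_less_iff)
    moreover have "C' * S' ^ j / S' ^ Suc m = C' * inverse S'"
      using True by (simp add: field_simps)
    ultimately show ?thesis
      using fls_residue_deriv_times_inverse_eq_subdegree(1)[of S'] True by (simp add: dS)
  next
    case False
    define d where "d = m - Suc j"
    have m: "m = Suc (j + d)" using False that by (simp add: d_def)
    have "fls_deriv (inverse S' ^ Suc d) = - of_nat (Suc d) * (C' * inverse S' ^ Suc (Suc d))"
      by (simp only: fls_deriv_power fls_inverse_deriv dS) (simp add: power2_eq_square algebra_simps)
    also have "C' * inverse S' ^ Suc (Suc d) = C' * S' ^ j / S' ^ Suc m"
      by (simp add: m field_simps power_add)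
    finally have "C' * S' ^ j / S' ^ Suc m = fls_const (- inverse (of_nat (Suc d))) * fls_deriv (inverse S' ^ Suc d)"
      by (simp add: fls_of_nat mult.assoc[symmetric] fls_const_mult_const del: of_nat_Suc)
    then show ?thesis
      using False fls_residue_deriv[of "inverse S' ^ Suc d"] by simp
  qed
  ultimately show ?thesis
    by (simp add: fls_nth_sum S'_def[symmetric] mult_delta_right del: power_Suc times_divide_eq_right)
qed

section \<open>The Laurent series built from an Eulerian polynomial\<close>

text \<open>
  The expansion of \<open>e^(-is\<theta>) P(x) / (1-x)^(m+1) = (\<Sum>r. (ar+1)^m e^(-is(ar+1)\<theta>))\<close> with
  \<open>x = e^(-2i\<theta>)\<close> and \<open>as = 2\<close>; differentiating the sum raises \<open>m\<close>.
\<close>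

definition eulerian_wave :: "int \<Rightarrow> nat \<Rightarrow> nat \<Rightarrow> complex fls" where
  "eulerian_wave a s m =
     fps_to_fls (fps_exp (-\<i>) ^ s * poly (map_poly of_int (eulerian_rec a m)) (fps_exp (-\<i>) ^ 2))
     / fps_to_fls (1 - fps_exp (-\<i>) ^ 2) ^ Suc m"

text \<open>Put x = Q^2 with Q = e^(-i\<theta>). As \<open>a * s = 2\<close>, differentiating Q^s
  g(x) gives -is Q^s (a x g'(x) + g(x)). The recursion of \<open>eulerian_rec\<close> says that this
  operator carries P_m / (1-x)^(m+1) to P_(m+1) / (1-x)^(m+2).\<close>

lemma fls_deriv_eulerian_wave:
  assumes "a * int s = 2"
  shows "fls_deriv (eulerian_wave a s m) = fls_const (-(\<i> * of_nat s)) * eulerian_wave a s (Suc m)"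
proof -
  define Q where "Q = fps_exp (-\<i>)"
  define c where "c = fps_const (\<i> * of_nat s)"
  define ev where "ev p = poly (map_poly of_int p) (Q\<^sup>2)" for p
  define P where "P = eulerian_rec a m"
  define D where "D = 1 - Q\<^sup>2"
  define N where "N k = Q ^ s * ev (eulerian_rec a k)" for k
  define V where "V = inverse (fps_to_fls D)"
  have dQ: "fps_deriv (Q ^ s) = - c * Q ^ s"
    unfolding Q_def fps_exp_power_mult c_def by (simp add: fps_const_neg[symmetric] del: fps_const_neg)
  have ca: "c * of_int a = 2 * fps_const \<i>"
  proof -
    have "\<i> * of_nat s * of_int a = 2 * \<i>"
      using arg_cong[OF assms, of "of_int :: int \<Rightarrow> complex"] by (simp add: algebra_simps)
    then show ?thesis
      unfolding c_def fps_of_int[symmetric] fps_const_mult numeral_fps_const by simp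
  qed
  have dQ2: "fps_deriv (Q\<^sup>2) = - (c * of_int a) * Q\<^sup>2"
    unfolding Q_def fps_exp_power_mult ca
    by (simp add: numeral_fps_const fps_const_neg[symmetric] del: fps_const_neg)
  have dN: "fps_deriv (N m) = - c * (N m + of_int a * Q\<^sup>2 * (Q ^ s * ev (pderiv P)))"
    unfolding N_def ev_def P_def[symmetric] fps_deriv_mult dQ fps_deriv_poly_of_int dQ2
    by (simp add: algebra_simps)
  have dD: "fps_deriv D = c * of_int a * Q\<^sup>2"
    by (simp add: D_def dQ2)
  \<comment> \<open>\<open>ev\<close> is a ring homomorphism, so it can be pushed through the
    recursion.\<close>
  have ev_pCons: "ev (pCons u p) = of_int u + Q\<^sup>2 * ev p" for u p
    by (simp add: ev_def map_poly_pCons)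
  have ev_add: "ev (p + q) = ev p + ev q" for p q
    by (simp add: ev_def map_poly_of_int_add)
  have ev_smult: "ev (smult u p) = of_int u * ev p" for u p
    by (induction p) (simp_all add: ev_pCons ev_def[of 0] algebra_simps)
  have ev_mult: "ev (p * q) = ev p * ev q" for p q
    by (induction p) (simp_all add: ev_pCons ev_add ev_smult ev_def[of 0] algebra_simps)
  have ev: "ev (p + q) = ev p + ev q" "ev (p * q) = ev p * ev q" "ev (of_nat k) = of_nat k"
     "ev [:u, v:] = of_int u + of_int v * Q\<^sup>2" for p q k u v
    by (simp_all add: ev_add ev_mult ev_pCons of_nat_poly ev_def[of 0])
  have N_Suc: "N (Suc m) = of_int a * Q\<^sup>2 * (D * (Q ^ s * ev (pderiv P)) + of_nat (Suc m) * N m) + D * N m"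
    unfolding N_def eulerian_rec.simps ev P_def[symmetric] D_def by (simp add: algebra_simps)
  \<comment> \<open>The numerator of the quotient rule for \<open>N m\<close> over D^(m+1), after
    cancelling D^m.\<close>
  have num: "fps_deriv (N m) * D - of_nat (Suc m) * N m * fps_deriv D = - c * N (Suc m)"
    unfolding dN dD N_Suc by (simp add: algebra_simps)
  have D0: "D \<noteq> 0"
    unfolding D_def Q_def fps_exp_power_mult by simp
  have W: "eulerian_wave a s k = fps_to_fls (N k) * V ^ Suc k" for k
    by (simp add: eulerian_wave_def N_def ev_def V_def D_def Q_def field_simps)
  have "fls_deriv (eulerian_wave a s m) =
          fps_to_fls (fps_deriv (N m)) * V ^ Suc m
          - of_nat (Suc m) * fps_to_fls (N m) * V ^ Suc (Suc m) * fps_to_fls (fps_deriv D)"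
    unfolding W fls_deriv_mult fls_deriv_power V_def fls_inverse_deriv fls_deriv_fps_to_fls
    by (simp add: power2_eq_square algebra_simps)
  also have "\<dots> = fps_to_fls (fps_deriv (N m) * D - of_nat (Suc m) * N m * fps_deriv D) * V ^ Suc (Suc m)"
    using D0 by (simp add: V_def fls_times_fps_to_fls fps_to_fls_of_nat field_simps)
  also have "\<dots> = fps_to_fls (- c) * eulerian_wave a s (Suc m)"
    unfolding num W by (simp add: fls_times_fps_to_fls)
  finally show ?thesis
    by (simp add: c_def)
qed

text \<open>Iterating the derivative rule reduces every coefficient to the wave with exponent 0,
  which is explicit.\<close>

lemma fls_nth_eulerian_wave:
  assumes "a * int s = 2"
  shows "(-(\<i> * of_nat s)) ^ m * eulerian_wave a s m $$ k
           = pochhammer (of_int k + 1) m * eulerian_wave a s 0 $$ (k + int m)"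
proof -
  define d where "d = -(\<i> * of_nat s)"
  have "(fls_deriv ^^ m) (eulerian_wave a s 0) = fls_const (d ^ m) * eulerian_wave a s m"
  proof (induction m)
    case (Suc m)
    have "(fls_deriv ^^ Suc m) (eulerian_wave a s 0)
            = fls_deriv (fls_const (d ^ m) * eulerian_wave a s m)"
      by (simp only: funpow.simps o_apply Suc)
    also have "\<dots> = fls_const (d ^ m) * (fls_const d * eulerian_wave a s (Suc m))"
      by (simp only: fls_deriv_mult_const_left fls_deriv_eulerian_wave[OF assms] d_def)
    finally show ?case by (simp only: power_Suc fls_const_mult_const[symmetric] mult_ac)
  qed simp
  then show ?thesis
    using fls_deriv_funpow_nth[of m "eulerian_wave a s 0" k] by (simp add: d_def[symmetric])
qed

text \<open>The wave is Q^s / (1 - Q^2). Its numerator is 1 at 0 and its denominator starts with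
  2i\<theta>, so there is a simple pole of residue 1/(2i), whatever s is. \<open>G\<close> is the
  denominator with the factor \<theta> removed.\<close>

lemma eulerian_wave_0_nth:
  shows "k < -1 \<Longrightarrow> eulerian_wave a s 0 $$ k = 0" and "eulerian_wave a s 0 $$ -1 = - \<i> / 2"
proof -
  define Q where "Q = fps_exp (-\<i>)"
  define G where "G = fps_shift 1 (1 - Q\<^sup>2)"
  have G0: "G $ 0 = 2 * \<i>"
    by (simp add: G_def Q_def fps_exp_power_mult)
  have D: "1 - Q\<^sup>2 = fps_X * G"
    by (rule fps_ext) (auto simp: G_def Q_def fps_exp_power_mult)
  have inv: "inverse (fps_to_fls G) = fps_to_fls (inverse G)"
    using G0 by (intro fls_inverse_fps_to_fls) simp
  have "eulerian_wave a s 0 = inverse fls_X * (fps_to_fls (Q ^ s) * inverse (fps_to_fls G))"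
    by (simp add: eulerian_wave_def Q_def[symmetric] D fls_times_fps_to_fls divide_inverse
          inverse_mult_distrib del: fls_inverse_X)
  then have W: "eulerian_wave a s 0 = fls_shift 1 (fps_to_fls (Q ^ s * inverse G))"
    by (simp add: inv fls_inverse_X fls_times_fps_to_fls fls_X_inv_times_conv_shift)
  show "k < -1 \<Longrightarrow> eulerian_wave a s 0 $$ k = 0" by (simp add: W)
  show "eulerian_wave a s 0 $$ -1 = - \<i> / 2"
    by (simp add: W fps_mult_nth G0 Q_def fps_exp_power_mult field_simps)
qed

section \<open>The Chebyshev sum at a sine\<close>

text \<open>Replace \<theta> by \<pi>/2 - \<theta> in the sine formula for U. The multiplied-out
  form \<open>chebyshev_rec_cos\<close> covers the zeros of the cosine too.\<close>

lemma chebyshev_U_even_sin: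
  "poly (chebyshev_U (2 * l)) (sin \<theta>) * cos \<theta> = (-1) ^ l * cos (of_nat (2 * l + 1) * \<theta>)"
proof -
  have "poly (chebyshev_U (2 * l)) (sin \<theta>) * cos \<theta>
          = sin (of_nat (2 * l + 1) * (of_real pi / 2 - \<theta>))"
  proof -
    have "cos (of_real pi / 2 - \<theta>) = sin \<theta>" "sin (of_real pi / 2 - \<theta>) = cos \<theta>"
      by (simp_all only: cos_diff sin_diff cos_of_real_pi_half sin_of_real_pi_half) simp_all
    then show ?thesis
      using chebyshev_rec_cos[of "2 * l" "of_real pi / 2 - \<theta>"] by (simp only: chebyshev_U_eq_rec)
  qed
  also have "of_nat (2 * l + 1) * (of_real pi / 2 - \<theta>) =
       (of_nat l * of_real pi) + (of_real pi / 2 - of_nat (2 * l + 1) * \<theta>)"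
    by (simp add: ring_distribs)
  also have "sin \<dots> = (-1) ^ l * cos (of_nat (2 * l + 1) * \<theta>)"
  proof -
    have "sin (of_nat l * of_real pi) = (0 :: complex)" "cos (of_nat l * of_real pi) = ((-1) ^ l :: complex)"
      by simp_all
    then show ?thesis by (simp add: sin_add sin_diff cos_diff)
  qed
  finally show ?thesis .
qed

definition chebyshev_eulerian_sum :: "nat \<Rightarrow> int poly \<Rightarrow> complex \<Rightarrow> complex" where
  "chebyshev_eulerian_sum n P z =
     (\<Sum>k<n. (-1) ^ k * of_int (coeff P k) * poly (chebyshev_U (2 * n - 2 * k - 2)) z)"

text \<open>Term k yields cos((2n-2k-1)\<theta>). Multiplied by q^(2n-1), its two exponentials
  become the powers k and 2n-1-k of q^2. By symmetry each carries its own coefficient of P, so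
  together the terms run through all of P.\<close>

lemma chebyshev_eulerian_sum_sin:
  assumes "palindromic (2 * n - 1) P" "n \<ge> 1"
  shows "exp (-\<i> * \<theta>) ^ (2 * n - 1) * (cos \<theta> * chebyshev_eulerian_sum n P (sin \<theta>))
           = (-1) ^ (n - 1) / 2 * (\<Sum>k<2*n. of_int (coeff P k) * (exp (-\<i> * \<theta>) ^ 2) ^ k)"
proof -
  define q where "q = exp (-\<i> * \<theta>)"
  have q: "q ^ (2 * n - 1) * (cos \<theta> * ((-1) ^ k * of_int (coeff P k) * poly (chebyshev_U (2 * n - 2 * k - 2)) (sin \<theta>)))
       = (-1) ^ (n - 1) / 2 * (of_int (coeff P k) * (q\<^sup>2) ^ k + of_int (coeff P (2 * n - Suc k)) * (q\<^sup>2) ^ (2 * n - Suc k))"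
    if "k < n" for k
  proof -
    define l where "l = n - 1 - k"
    have n: "n = Suc (k + l)" using that by (simp add: l_def)
    have sym: "coeff P (2 * n - Suc k) = coeff P k"
      using assms(1) that unfolding palindromic_def by (auto dest!: spec[of _ k])
    have cos: "cos (of_nat (2 * l + 1) * \<theta>) = (inverse q ^ (2 * l + 1) + q ^ (2 * l + 1)) / 2"
    proof -
      have "q ^ (2 * l + 1) = exp (- (\<i> * (of_nat (2 * l + 1) * \<theta>)))"
        by (simp only: q_def exp_of_nat_mult[symmetric]) (simp add: algebra_simps)
      then show ?thesis
        by (simp only: cos_exp_eq power_inverse exp_minus inverse_inverse_eq)
    qed
    have e1: "q ^ (2 * n - 1) * cos (of_nat (2 * l + 1) * \<theta>) = ((q\<^sup>2) ^ k + (q\<^sup>2) ^ (2 * n - Suc k)) / 2"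
    proof -
      define x where "x = q ^ (2 * l + 1)"
      have "x \<noteq> 0" by (simp add: x_def q_def)
      have "2 * n - 1 = 2 * k + (2 * l + 1)" "2 * n - Suc k = k + (2 * l + 1)"
        by (simp_all add: n)
      moreover have "(q\<^sup>2) ^ (2 * l + 1) = x\<^sup>2"
        by (simp only: x_def power_mult[symmetric] mult.commute)
      ultimately have pows: "q ^ (2 * n - 1) = (q\<^sup>2) ^ k * x" "(q\<^sup>2) ^ (2 * n - Suc k) = (q\<^sup>2) ^ k * x\<^sup>2"
        by (simp_all only: power_add x_def power_mult)
      have "cos (of_nat (2 * l + 1) * \<theta>) = (inverse x + x) / 2"
        using cos by (simp only: x_def power_inverse)
      moreover have "x * (inverse x + x) = 1 + x\<^sup>2"
        using \<open>x \<noteq> 0\<close> by (simp add: distrib_left power2_eq_square)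
      ultimately show ?thesis
        unfolding pows by (simp add: mult.assoc) (simp add: algebra_simps)
    qed
    \<comment> \<open>The sign of U and the alternating sign combine to one independent of
      k.\<close>
    have e2: "(-1) ^ k * (-1) ^ l = ((-1) ^ (n - 1) :: complex)"
      by (simp add: n power_add)
    have e3: "2 * n - 2 * k - 2 = 2 * l" by (simp add: n)
    have e4: "cos \<theta> * poly (chebyshev_U (2 * l)) (sin \<theta>) = (-1) ^ l * cos (of_nat (2 * l + 1) * \<theta>)"
      using chebyshev_U_even_sin[of l \<theta>] by (simp add: mult.commute)
    have "q ^ (2 * n - 1) * (cos \<theta> * ((-1) ^ k * of_int (coeff P k) * poly (chebyshev_U (2 * n - 2 * k - 2)) (sin \<theta>)))
        = of_int (coeff P k) * (-1) ^ k * q ^ (2 * n - 1) * (cos \<theta> * poly (chebyshev_U (2 * l)) (sin \<theta>))"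
      unfolding e3 by (simp only: mult_ac)
    also have "\<dots> = of_int (coeff P k) * ((-1) ^ k * (-1) ^ l) * (q ^ (2 * n - 1) * cos (of_nat (2 * l + 1) * \<theta>))"
      unfolding e4 by (simp only: mult_ac)
    also have "\<dots> = (-1) ^ (n - 1) / 2 * (of_int (coeff P k) * (q\<^sup>2) ^ k + of_int (coeff P (2 * n - Suc k)) * (q\<^sup>2) ^ (2 * n - Suc k))"
      unfolding e1 e2 sym by (simp add: field_simps)
    finally show ?thesis .
  qed
  define g where "g k = of_int (coeff P k) * (q\<^sup>2) ^ k" for k
  have "(\<Sum>k<2*n. g k) = (\<Sum>k<n. g k) + (\<Sum>k=n..<2*n. g k)"
    by (simp add: lessThan_atLeast0 sum.atLeastLessThan_concat)
  also have "(\<Sum>k=n..<2*n. g k) = (\<Sum>k<n. g (2 * n - Suc k))"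
    by (rule sum.reindex_bij_witness[of _ "\<lambda>k. 2 * n - Suc k" "\<lambda>k. 2 * n - Suc k"]) auto
  finally have g: "(\<Sum>k<2*n. g k) = (\<Sum>k<n. g k + g (2 * n - Suc k))"
    by (simp add: sum.distrib)
  have "q ^ (2 * n - 1) * (cos \<theta> * chebyshev_eulerian_sum n P (sin \<theta>))
          = (\<Sum>k<n. (-1) ^ (n - 1) / 2 * (g k + g (2 * n - Suc k)))"
    unfolding chebyshev_eulerian_sum_def sum_distrib_left g_def
    by (intro sum.cong refl q) simp
  then show ?thesis
    by (simp only: q_def[symmetric] g_def[symmetric] g sum_distrib_left)
qed

section \<open>The coefficient formula for both types\<close>

lemma poly_of_int_altdef:
  assumes "\<And>k. k \<ge> N \<Longrightarrow> coeff P k = 0"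
  shows "poly (map_poly of_int P) (x::'a::comm_ring_1) = (\<Sum>k<N. of_int (coeff P k) * x ^ k)"
  using assms
proof (induction P arbitrary: N)
  case (pCons c P)
  show ?case
  proof (cases N)
    case 0
    then have "pCons c P = 0" using pCons.prems by (intro poly_eqI) simp
    then show ?thesis using 0 by simp
  next
    case (Suc M)
    have "poly (map_poly of_int P) x = (\<Sum>k<M. of_int (coeff P k) * x ^ k)"
      using pCons.prems[of "Suc _"] Suc by (intro pCons.IH) simp
    then show ?thesis
      by (simp add: Suc sum.lessThan_Suc_shift map_poly_pCons sum_distrib_left mult.left_commute del: sum.lessThan_Suc)
  qed
qed simp

text \<open>Write 1 as C^2 + S^2 and Q as C - iS; then 1 - Q^2 = 2iS(C - iS). This trades the
  denominators of the wave for powers of the sine.\<close>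

lemma one_minus_fps_exp_sq: "1 - fps_exp (-\<i>) ^ 2 = fps_const (2 * \<i>) * fps_exp (-\<i>) * fps_sin 1"
proof -
  define S C I where "S = fps_sin (1::complex)" and "C = fps_cos (1::complex)" and "I = fps_const \<i>"
  have Q: "fps_exp (-\<i>) = C - I * S"
    using fps_exp_minus_ii_sin_cos[of 1] by (simp add: S_def C_def I_def)
  have one: "1 = C\<^sup>2 + S\<^sup>2"
    using fps_sin_cos_sum_of_squares[of "1::complex"] by (simp add: S_def C_def)
  have "I * I = -1"
    by (simp add: I_def fps_const_neg[symmetric] del: fps_const_neg)
  then have II: "I * (I * x) = -x" for x
    by (simp only: mult.assoc[symmetric]) simp
  have "fps_const (2 * \<i>) = 2 * I"
    by (simp add: I_def numeral_fps_const)
  then show ?thesis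
    unfolding Q S_def[symmetric] by (subst one) (simp add: power2_eq_square algebra_simps II)
qed

text \<open>Type B is (a, t) = (2, 0) and type A is (1, 1); t + 1 is the exponent s of the
  wave.\<close>

lemma fps_nth_Arcsin_power_chebyshev_eulerian_sum:
  fixes n q t :: nat
  defines "m \<equiv> 2 * n - 1 + t"
  assumes a: "a * (int t + 1) = 2" and n: "n \<ge> 1"
  shows "fps_expansion (\<lambda>z. Arcsin z ^ q * chebyshev_eulerian_sum n (eulerian_rec a m) z) 0 $ m
           = (-1) ^ (n - 1) / 2 * of_int a ^ m * fact m * (if q = m then 1 else 0)"
proof -
  define P where "P = eulerian_rec a m"
  define F where "F = (\<lambda>z. Arcsin z ^ q * chebyshev_eulerian_sum n P z)"
  define \<Phi> where "\<Phi> = fps_expansion F 0"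
  define Q S C where "Q = fps_exp (-\<i>)" and "S = fps_sin (1::complex)" and "C = fps_cos (1::complex)"
  define PQ where "PQ = poly (map_poly of_int P) (Q\<^sup>2)"
  define c :: complex where "c = (-1) ^ (n - 1) / 2"
  have pal: "palindromic (2 * n - 1) P"
    unfolding P_def m_def using a by (rule palindromic_eulerian_rec)
  have "F analytic_on {0}"
  proof -
    have "F holomorphic_on ball 0 1"
      unfolding F_def chebyshev_eulerian_sum_def
      by (intro holomorphic_intros holomorphic_on_Arcsin)
         (auto simp: dist_norm intro: le_less_trans[OF abs_Re_le_cmod])
    then show ?thesis unfolding analytic_at by (intro exI[of _ "ball 0 1"]) auto
  qed
  then have F: "F has_fps_expansion \<Phi>"
    unfolding \<Phi>_def by (rule analytic_at_imp_has_fps_expansion_0)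
  have PQ: "PQ = (\<Sum>k<2*n. fps_const (of_int (coeff P k)) * (Q\<^sup>2) ^ k)"
    unfolding PQ_def using pal n
    by (subst poly_of_int_altdef[of "2 * n"]) (auto simp: palindromic_def fps_of_int)
  \<comment> \<open>The unit disc lies in the strip |Re \<theta>| < \<pi>/2, where Arcsin inverts
    the sine.\<close>
  have ev: "eventually (\<lambda>\<theta>. exp (-\<i> * \<theta>) ^ (2 * n - 1) * (cos \<theta> * (F \<circ> sin) \<theta>) =
      c * (\<theta> ^ q * (\<Sum>k<2*n. of_int (coeff P k) * (exp (-\<i> * \<theta>) ^ 2) ^ k))) (nhds 0)"
  proof -
    have "eventually (\<lambda>\<theta>. \<theta> \<in> ball (0::complex) 1) (nhds 0)"
      by (intro eventually_nhds_in_open) auto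
    then show ?thesis
    proof eventually_elim
      case (elim \<theta>)
      then have "\<bar>Re \<theta>\<bar> < pi / 2"
        using abs_Re_le_cmod[of \<theta>] pi_gt3 by auto
      then have F': "(F \<circ> sin) \<theta> = \<theta> ^ q * chebyshev_eulerian_sum n P (sin \<theta>)"
        by (simp add: F_def Arcsin_sin)
      have "exp (-\<i> * \<theta>) ^ (2 * n - 1) * (cos \<theta> * (F \<circ> sin) \<theta>) =
          \<theta> ^ q * (exp (-\<i> * \<theta>) ^ (2 * n - 1) * (cos \<theta> * chebyshev_eulerian_sum n P (sin \<theta>)))"
        unfolding F' by (simp only: mult.left_commute)
      then show ?case
        unfolding chebyshev_eulerian_sum_sin[OF pal n] c_def by (simp only: mult.left_commute)
    qed
  qed
  have lhs: "(\<lambda>\<theta>. exp (-\<i> * \<theta>) ^ (2 * n - 1) * (cos \<theta> * (F \<circ> sin) \<theta>)) has_fps_expansion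
          Q ^ (2 * n - 1) * (C * (\<Phi> oo S))"
    unfolding Q_def C_def S_def by (intro fps_expansion_intros F) simp
  have rhs: "(\<lambda>\<theta>. c * (\<theta> ^ q * (\<Sum>k<2*n. of_int (coeff P k) * (exp (-\<i> * \<theta>) ^ 2) ^ k)))
      has_fps_expansion fps_const c * (fps_X ^ q * PQ)"
    unfolding Q_def PQ by (intro fps_expansion_intros)
  \<comment> \<open>Functions equal near 0 have the same expansion, so from here on the argument is
    purely formal.\<close>
  have eq: "Q ^ (2 * n - 1) * (C * (\<Phi> oo S)) = fps_const c * (fps_X ^ q * PQ)"
    using lhs rhs unfolding has_fps_expansion_cong[OF ev refl] by (rule fps_expansion_unique_complex)
  define Q' S' where "Q' = fps_to_fls Q" and "S' = fps_to_fls S"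
  define W where "W = eulerian_wave a (Suc t) m"
  have [simp]: "Q' \<noteq> 0" by (simp add: Q'_def Q_def)
  have "S $ Suc 0 \<noteq> 0" by (simp add: S_def)
  then have [simp]: "S' \<noteq> 0" by (auto simp: S'_def)
  have eq': "Q' ^ (2 * n - 1) * fps_to_fls ((\<Phi> oo S) * C) = fls_const c * (fls_X ^ q * fps_to_fls PQ)"
    using arg_cong[OF eq, of fps_to_fls]
    by (simp add: fls_times_fps_to_fls fps_to_fls_power Q'_def mult_ac)
  have W: "W = Q' ^ Suc t * fps_to_fls PQ / (fls_const (2 * \<i>) * Q' * S') ^ Suc m"
    unfolding W_def eulerian_wave_def one_minus_fps_exp_sq
    by (simp add: Q_def[symmetric] S_def[symmetric] P_def[symmetric] PQ_def[symmetric] Q'_def S'_def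
        fls_times_fps_to_fls fps_to_fls_power)
  \<comment> \<open>This count makes all powers of \<open>Q'\<close> cancel: the denominator of the
    wave has m+1 of them, its numerator t+1, and the cosine sum 2n-1.\<close>
  have Sm: "Suc m = 2 * n - 1 + Suc t"
    by (simp add: m_def)
  have "fps_to_fls ((\<Phi> oo S) * C) / S' ^ Suc m = fls_const (c * (2 * \<i>) ^ Suc m) * (fls_X ^ q * W)"
  proof -
    have "Q' ^ (2 * n - 1) * (fls_const (c * (2 * \<i>) ^ Suc m) * (fls_X ^ q * W))
            = Q' ^ (2 * n - 1) * Q' ^ Suc t / Q' ^ Suc m * (fls_const c * (fls_X ^ q * fps_to_fls PQ)) / S' ^ Suc m"
      unfolding W power_mult_distrib fls_const_mult_const[symmetric] fls_const_power
      by (simp add: fls_const_nonzero)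
    also have "Q' ^ (2 * n - 1) * Q' ^ Suc t / Q' ^ Suc m = 1"
      unfolding Sm power_add by simp
    finally have "Q' ^ (2 * n - 1) * (fls_const (c * (2 * \<i>) ^ Suc m) * (fls_X ^ q * W))
                    = Q' ^ (2 * n - 1) * (fps_to_fls ((\<Phi> oo S) * C) / S' ^ Suc m)"
      by (simp only: eq'[symmetric] mult_1 times_divide_eq_right)
    moreover have "Q' ^ (2 * n - 1) \<noteq> 0" by simp
    ultimately show ?thesis by (metis mult_left_cancel)
  qed
  then have "\<Phi> $ m = (fls_const (c * (2 * \<i>) ^ Suc m) * (fls_X ^ q * W)) $$ -1"
    using fls_nth_eq_fls_residue_sin_subst[of \<Phi> m] by (simp only: S'_def S_def C_def)
  then have \<Phi>: "\<Phi> $ m = c * (2 * \<i>) ^ Suc m * W $$ (-1 - int q)"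
    by (simp add: fls_X_power_times_conv_shift)
  \<comment> \<open>\<open>d\<close> is the factor produced by each differentiation of the wave; a d
    = -2i will turn the powers of 2i into powers of a.\<close>
  define d where "d = -(\<i> * of_nat (Suc t))"
  have d0: "d \<noteq> 0" by (simp add: d_def del: of_nat_Suc)
  have ad: "of_int a * d = - (2 * \<i>)"
  proof -
    have "of_int a * of_nat (Suc t) = (2 :: complex)"
      using arg_cong[OF a, of "of_int :: int \<Rightarrow> complex"] by (simp add: algebra_simps)
    moreover have "of_int a * d = - (\<i> * (of_int a * of_nat (Suc t)))"
      by (simp add: d_def algebra_simps)
    ultimately show ?thesis by simp
  qed
  have "d ^ m * W $$ (-1 - int q) = pochhammer (- of_nat q) m * eulerian_wave a (Suc t) 0 $$ (int m - int q - 1)"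
  proof -
    have "a * int (Suc t) = 2"
      using a by (simp add: algebra_simps)
    moreover have "of_int (-1 - int q) + 1 = (- of_nat q :: complex)" "-1 - int q + int m = int m - int q - 1"
      by simp_all
    ultimately show ?thesis
      using fls_nth_eulerian_wave[of a "Suc t" m "-1 - int q"] by (simp only: W_def d_def)
  qed
  \<comment> \<open>For q < m the rising factorial contains the factor 0. For q > m the index lies
    below the pole. For q = m the rising factorial is (-1)^m m! and the coefficient is the residue
    -i/2.\<close>
  also have "\<dots> = (-1) ^ m * fact m * (- \<i> / 2) * (if q = m then 1 else 0)"
    using eulerian_wave_0_nth(1)[of "int m - int q - 1" a "Suc t"] eulerian_wave_0_nth(2)[of a "Suc t"]
    by (cases q m rule: linorder_cases) (simp_all add: pochhammer_of_nat_eq_0_lemma pochhammer_same)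
  finally have dW: "d ^ m * W $$ (-1 - int q) = \<dots>" .
  have "d ^ m * \<Phi> $ m = c * (2 * \<i>) ^ Suc m * (d ^ m * W $$ (-1 - int q))"
    unfolding \<Phi> by (simp only: mult_ac)
  also have "\<dots> = c * ((2 * \<i>) ^ m * (-1) ^ m) * fact m * (if q = m then 1 else 0) * ((2 * \<i>) * (- \<i> / 2))"
    unfolding dW power_Suc by (simp only: mult_ac)
  also have "(2 * \<i>) ^ m * (-1) ^ m = (- (2 * \<i>)) ^ m"
    by (simp only: power_mult_distrib[symmetric]) simp
  finally have "d ^ m * \<Phi> $ m = c * (- (2 * \<i>)) ^ m * fact m * (if q = m then 1 else 0)"
    by simp
  then have "d ^ m * \<Phi> $ m = d ^ m * (c * of_int a ^ m * fact m * (if q = m then 1 else 0))"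
    unfolding ad[symmetric] by (simp only: power_mult_distrib mult_ac)
  then show ?thesis
    using d0 by (simp add: \<Phi>_def F_def P_def c_def)
qed

theorem lemma6p2:
  fixes n p :: nat
  assumes "n \<ge> 1" and "p \<ge> 1"
  shows "fps_nth (fps_expansion (\<lambda>z. Arcsin z ^ (2 * p - 1) *
             (\<Sum>k = 0..n - 1. (-1) ^ k * of_int (eulerian_B (2 * n - 1) k)
                * poly (chebyshev_U (2 * n - 2 * k - 2)) z)) 0) (2 * n - 1)
           = (-1) ^ (n - 1) * 2 ^ (2 * n - 2) * fact (2 * n - 1) * (if p = n then 1 else 0)
         \<and> fps_nth (fps_expansion (\<lambda>z. Arcsin z ^ (2 * p) *
             (\<Sum>k = 0..n - 1. (-1) ^ k * of_int (eulerian_A (2 * n) k)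
                * poly (chebyshev_U (2 * n - 2 * k - 2)) z)) 0) (2 * n)
           = (-1) ^ (n - 1) / 2 * fact (2 * n) * (if p = n then 1 else 0)"
proof -
  have sum: "(\<Sum>k = 0..n - 1. (-1) ^ k * of_int (coeff P k) * poly (chebyshev_U (2 * n - 2 * k - 2)) z)
      = chebyshev_eulerian_sum n P z" for P z
    unfolding chebyshev_eulerian_sum_def using assms by (intro sum.cong) auto
  have idx: "2 * n - 1 + 0 = 2 * n - 1" "2 * n - 1 + 1 = 2 * n" using assms by simp_all
  have B: "fps_expansion (\<lambda>z. Arcsin z ^ (2 * p - 1) * chebyshev_eulerian_sum n (eulerian_rec 2 (2 * n - 1)) z) 0 $ (2 * n - 1)
      = (-1) ^ (n - 1) / 2 * 2 ^ (2 * n - 1) * fact (2 * n - 1) * (if 2 * p - 1 = 2 * n - 1 then 1 else 0)"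
    using fps_nth_Arcsin_power_chebyshev_eulerian_sum[of 2 0 n "2 * p - 1", unfolded idx] assms by simp
  have A: "fps_expansion (\<lambda>z. Arcsin z ^ (2 * p) * chebyshev_eulerian_sum n (eulerian_rec 1 (2 * n)) z) 0 $ (2 * n)
      = (-1) ^ (n - 1) / 2 * fact (2 * n) * (if 2 * p = 2 * n then 1 else 0)"
    using fps_nth_Arcsin_power_chebyshev_eulerian_sum[of 1 1 n "2 * p", unfolded idx] assms by simp
  \<comment> \<open>Absorbs the factor 1/2 of the general formula in type B, where a^m =
    2^(2n-1).\<close>
  have pow: "2 ^ (2 * n - 1) = 2 * (2 ^ (2 * n - 2) :: complex)"
    using assms by (cases n) simp_all
  have delta: "2 * p - 1 = 2 * n - 1 \<longleftrightarrow> p = n" "2 * p = 2 * n \<longleftrightarrow> p = n"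
    using assms by auto
  show ?thesis
    unfolding eulerian_A_def eulerian_B_def eulerian_poly_A_eq_rec eulerian_poly_B_eq_rec sum A B pow delta
    by simp
qed

end
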